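(* Let $p=q=3$ and let $(M,g)$ be one of the two Riemannian manifolds $$\left(\mathbb{S}^{p-1}\times\left[0,\tfrac{\pi}{2}\right)\times\mathbb{S}^{q-1},\ \sin^2 r\,g_{\mathbb{S}^{p-1}}+dr^2+\cos^2 r\,g_{\mathbb{S}^{q-1}}\right)$$ or $$\left(\mathbb{S}^{p-1}\times[0,+\infty)\times\mathbb{S}^{q-1},\ \sinh^2 r\,g_{\mathbb{S}^{p-1}}+dr^2+\cosh^2 r\,g_{\mathbb{S}^{q-1}}\right).$$ Write $\mathbb{S}^{q-1}\subset M$ for the focal variety $\{r=0\}$. Then, in each of the two cases: (i) On the region $r>0$: if $F=F(r)$ is a radial (i.e. depending only on $r$) proper harmonic function, then the function $G(r)=r\,F(r)$ is proper biharmonic. (ii) There exists a nonradial proper harmonic function $F^*(r,\vartheta_{p-1},\varphi_{q-1})$ on $M\setminus\mathbb{S}^{q-1}$ such that the function $G=r\,F^*$ is not biharmonic on $M\setminus\mathbb{S}^{q-1}$.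
   Context: $\mathbb{S}^{n}$ is the Euclidean unit sphere with standard metric $g_{\mathbb{S}^n}$. In both manifolds the factor $\mathbb{S}^{p-1}$ is collapsed to a point at $r=0$, so that the locus $r=0$ is a copy of $\mathbb{S}^{q-1}$ (the focal variety) and $r$ is the distance from it; $M\setminus\mathbb{S}^{q-1}$ is the region $r>0$, that is $\mathbb{S}^{p-1}\times I\times\mathbb{S}^{q-1}$ with the given metric, where $I=(0,\pi/2)$ in the first case and $I=(0,+\infty)$ in the second. The symbols $\vartheta_{p-1}$ and $\varphi_{q-1}$ denote points (coordinates) on $\mathbb{S}^{p-1}$ and $\mathbb{S}^{q-1}$ respectively. A function is radial if it depends only on $r$. For a Riemannian manifold, $\Delta F=\operatorname{div}(\nabla F)$ is the Laplace-Beltrami operator. A smooth real-valued function $F$ is harmonic if $\Delta F=0$, and proper harmonic if moreover $F$ is not identically zero; it is biharmonic if $\Delta^2F=\Delta(\Delta F)=0$, and proper biharmonic if moreover $\Delta F$ is not identically zero. *)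

theory Defs
  imports "HOL-Analysis.Analysis"
begin

definition partial :: "'n \<Rightarrow> (real^'n \<Rightarrow> 'b::real_normed_vector) \<Rightarrow> real^'n::finite \<Rightarrow> 'b" where
  "partial i f x = vector_derivative (\<lambda>t. f (x + t *\<^sub>R axis i 1)) (at 0)"

text \<open>On an open set, \<open>C\<^sup>\<infinity>\<close> means that all iterated partial derivatives
  (of every order, including order 0) are differentiable.\<close>
definition smooth_on :: "(real^'n::finite) set \<Rightarrow> (real^'n \<Rightarrow> 'b::real_normed_vector) \<Rightarrow> bool" where
  "smooth_on U f \<longleftrightarrow> (\<forall>is. foldr partial is f differentiable_on U)"

text \<open>A manifold is a subset of a normed space \<open>'e\<close>, covered by local parametrizations
  \<open>(U, X)\<close> with \<open>U\<close> open in \<open>\<real>\<^sup>n\<close> and \<open>X\<close> injective on \<open>U\<close>. A Riemannian metric \<open>g p v w\<close> is given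
  on ambient vectors \<open>v, w\<close>; only its values on vectors tangent to the manifold at \<open>p\<close> are used.\<close>

type_synonym ('n, 'e) parametrization = "(real^'n) set \<times> (real^'n \<Rightarrow> 'e)"

definition metric_matrix ::
  "('e \<Rightarrow> 'e \<Rightarrow> 'e \<Rightarrow> real) \<Rightarrow> (real^'n \<Rightarrow> 'e::real_normed_vector) \<Rightarrow> real^'n::finite \<Rightarrow> real^'n^'n" where
  "metric_matrix g X x = (\<chi> i j. g (X x) (partial i X x) (partial j X x))"

text \<open>Components \<open>g\<^sup>i\<^sup>j \<partial>\<^sub>j f\<close> of the gradient.\<close>
definition local_grad ::
  "('e \<Rightarrow> 'e \<Rightarrow> 'e \<Rightarrow> real) \<Rightarrow> (real^'n \<Rightarrow> 'e::real_normed_vector) \<Rightarrow>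
    (real^'n \<Rightarrow> real) \<Rightarrow> real^'n::finite \<Rightarrow> real^'n" where
  "local_grad g X f x = matrix_inv (metric_matrix g X x) *v (\<chi> j. partial j f x)"

definition local_div ::
  "('e \<Rightarrow> 'e \<Rightarrow> 'e \<Rightarrow> real) \<Rightarrow> (real^'n \<Rightarrow> 'e::real_normed_vector) \<Rightarrow>
    (real^'n \<Rightarrow> real^'n) \<Rightarrow> real^'n::finite \<Rightarrow> real" where
  "local_div g X V x =
    (\<Sum>i\<in>UNIV. partial i (\<lambda>y. sqrt (det (metric_matrix g X y)) * V y $ i) x)
      / sqrt (det (metric_matrix g X x))"

definition local_laplacian ::
  "('e \<Rightarrow> 'e \<Rightarrow> 'e \<Rightarrow> real) \<Rightarrow> (real^'n \<Rightarrow> 'e::real_normed_vector) \<Rightarrow>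
    (real^'n \<Rightarrow> real) \<Rightarrow> real^'n::finite \<Rightarrow> real" where
  "local_laplacian g X f = local_div g X (local_grad g X f)"

text \<open>The value at \<open>p\<close> is computed in some chart of the atlas around \<open>p\<close>; for smooth \<open>F\<close> and a
  smooth atlas it does not depend on the chart.\<close>
definition laplace_beltrami ::
  "('n::finite, 'e::real_normed_vector) parametrization set \<Rightarrow> ('e \<Rightarrow> 'e \<Rightarrow> 'e \<Rightarrow> real) \<Rightarrow>
    ('e \<Rightarrow> real) \<Rightarrow> 'e \<Rightarrow> real" where
  "laplace_beltrami A g F p =
    (let (U, X) = (SOME (U, X). (U, X) \<in> A \<and> p \<in> X ` U)
     in local_laplacian g X (F \<circ> X) (the_inv_into U X p))"

type_synonym point = "(real^3) \<times> real \<times> (real^3)"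

definition region :: "real set \<Rightarrow> point set" where
  "region I = sphere 0 1 \<times> I \<times> sphere 0 1"

text \<open>\<open>a(r)\<^sup>2 g + dr\<^sup>2 + b(r)\<^sup>2 g\<close>, where the round metric \<open>g\<close> of the unit sphere is the restriction of the
  Euclidean inner product to tangent vectors.\<close>
fun warped_metric :: "(real \<Rightarrow> real) \<Rightarrow> (real \<Rightarrow> real) \<Rightarrow> point \<Rightarrow> point \<Rightarrow> point \<Rightarrow> real" where
  "warped_metric a b (\<theta>, r, \<phi>) (v, s, w) (v', s', w') =
    (a r)\<^sup>2 * (v \<bullet> v') + s * s' + (b r)\<^sup>2 * (w \<bullet> w')"

text \<open>Inverse stereographic projection from the pole \<open>(0, 0, \<epsilon>)\<close>, for \<open>\<epsilon> = \<plusminus>1\<close>.\<close>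
definition stereo :: "real \<Rightarrow> real \<Rightarrow> real \<Rightarrow> real^3" where
  "stereo \<epsilon> u v = (1 / (u\<^sup>2 + v\<^sup>2 + 1)) *\<^sub>R vector [2 * u, 2 * v, \<epsilon> * (u\<^sup>2 + v\<^sup>2 - 1)]"

definition stereo_param :: "real \<Rightarrow> real \<Rightarrow> real^5 \<Rightarrow> point" where
  "stereo_param \<epsilon> \<delta> x = (stereo \<epsilon> (x $ 1) (x $ 2), x $ 3, stereo \<delta> (x $ 4) (x $ 5))"

definition region_atlas :: "real set \<Rightarrow> (5, point) parametrization set" where
  "region_atlas I = {({x. x $ 3 \<in> I}, stereo_param \<epsilon> \<delta>) | \<epsilon> \<delta>. \<epsilon> \<in> {1, -1} \<and> \<delta> \<in> {1, -1}}"

definition laplacian :: "real set \<Rightarrow> (real \<Rightarrow> real) \<Rightarrow> (real \<Rightarrow> real) \<Rightarrow> (point \<Rightarrow> real) \<Rightarrow> point \<Rightarrow> real" where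
  "laplacian I a b = laplace_beltrami (region_atlas I) (warped_metric a b)"

definition smooth :: "real set \<Rightarrow> (point \<Rightarrow> real) \<Rightarrow> bool" where
  "smooth I F \<longleftrightarrow> (\<forall>(U, X)\<in>region_atlas I. smooth_on U (F \<circ> X))"

definition harmonic :: "real set \<Rightarrow> (real \<Rightarrow> real) \<Rightarrow> (real \<Rightarrow> real) \<Rightarrow> (point \<Rightarrow> real) \<Rightarrow> bool" where
  "harmonic I a b F \<longleftrightarrow> smooth I F \<and> (\<forall>p\<in>region I. laplacian I a b F p = 0)"

definition proper_harmonic :: "real set \<Rightarrow> (real \<Rightarrow> real) \<Rightarrow> (real \<Rightarrow> real) \<Rightarrow> (point \<Rightarrow> real) \<Rightarrow> bool" where
  "proper_harmonic I a b F \<longleftrightarrow> harmonic I a b F \<and> (\<exists>p\<in>region I. F p \<noteq> 0)"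

definition biharmonic :: "real set \<Rightarrow> (real \<Rightarrow> real) \<Rightarrow> (real \<Rightarrow> real) \<Rightarrow> (point \<Rightarrow> real) \<Rightarrow> bool" where
  "biharmonic I a b F \<longleftrightarrow>
    smooth I F \<and> (\<forall>p\<in>region I. laplacian I a b (laplacian I a b F) p = 0)"

definition proper_biharmonic :: "real set \<Rightarrow> (real \<Rightarrow> real) \<Rightarrow> (real \<Rightarrow> real) \<Rightarrow> (point \<Rightarrow> real) \<Rightarrow> bool" where
  "proper_biharmonic I a b F \<longleftrightarrow>
    biharmonic I a b F \<and> (\<exists>p\<in>region I. laplacian I a b F p \<noteq> 0)"

definition radial :: "real set \<Rightarrow> (point \<Rightarrow> real) \<Rightarrow> bool" where
  "radial I F \<longleftrightarrow> (\<exists>f. \<forall>(\<theta>, r, \<phi>)\<in>region I. F (\<theta>, r, \<phi>) = f r)"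

definition times_r :: "(point \<Rightarrow> real) \<Rightarrow> point \<Rightarrow> real" where
  "times_r F = (\<lambda>(\<theta>, r, \<phi>). r * F (\<theta>, r, \<phi>))"

lemma stereo_nth:
  "stereo e u v $ 1 = 2 * u / (u\<^sup>2 + v\<^sup>2 + 1)"
  "stereo e u v $ 2 = 2 * v / (u\<^sup>2 + v\<^sup>2 + 1)"
  "stereo e u v $ 3 = e * (u\<^sup>2 + v\<^sup>2 - 1) / (u\<^sup>2 + v\<^sup>2 + 1)"
  by (simp_all add: stereo_def)

lemma norm_vec3: "x \<in> sphere 0 1 \<longleftrightarrow> (x $ 1)\<^sup>2 + (x $ 2)\<^sup>2 + (x $ 3)\<^sup>2 = 1" for x :: "real^3"
  by (simp add: norm_eq_1 inner_vec_def sum_3 power2_eq_square)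

lemma stereo_in_sphere:
  assumes "e \<in> {1, -1}"
  shows "stereo e u v \<in> sphere 0 1"
proof -
  have p: "u\<^sup>2 + v\<^sup>2 + 1 \<noteq> 0" using zero_le_power2[of u] zero_le_power2[of v] by linarith
  have e: "(e * t) ^ 2 = t ^ 2" for t using assms by auto
  have "(2 * u) ^ 2 + (2 * v) ^ 2 + (u\<^sup>2 + v\<^sup>2 - 1) ^ 2 = (u\<^sup>2 + v\<^sup>2 + 1) ^ 2"
    by algebra
  then show ?thesis
    unfolding norm_vec3 stereo_nth power_divide e using p
    by (simp add: add_divide_distrib[symmetric])
qed

text \<open>The chart inverse is \<open>(x, y, z) \<mapsto> (x, y) / (1 - \<epsilon> z)\<close>.\<close>
lemma stereo_inverse:
  assumes "e \<in> {1, -1}"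
  shows "stereo e u v $ 1 / (1 - e * stereo e u v $ 3) = u"
    and "stereo e u v $ 2 / (1 - e * stereo e u v $ 3) = v"
proof -
  have p: "u\<^sup>2 + v\<^sup>2 + 1 \<noteq> 0" using zero_le_power2[of u] zero_le_power2[of v] by linarith
  have e: "e * (e * t) = t" for t using assms by auto
  have "1 - e * stereo e u v $ 3 = 2 / (u\<^sup>2 + v\<^sup>2 + 1)"
    using p by (simp add: stereo_nth divide_simps e)
  then show "stereo e u v $ 1 / (1 - e * stereo e u v $ 3) = u"
    and "stereo e u v $ 2 / (1 - e * stereo e u v $ 3) = v"
    using p by (simp_all add: stereo_nth)
qed

lemma stereo_surj:
  assumes x: "x \<in> sphere 0 1" and e: "e \<in> {1, -1}" and ne: "e * x $ 3 \<noteq> 1"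
  shows "stereo e (x $ 1 / (1 - e * x $ 3)) (x $ 2 / (1 - e * x $ 3)) = x"
proof -
  define d where "d = 1 - e * x $ 3"
  have d: "d \<noteq> 0" using ne by (simp add: d_def)
  have ee: "e * e = 1" using e by auto
  have n: "(x $ 1)\<^sup>2 + (x $ 2)\<^sup>2 + (x $ 3)\<^sup>2 = 1" using x norm_vec3 by blast
  have sq: "(x $ 1)\<^sup>2 + (x $ 2)\<^sup>2 = d * (2 - d)"
    unfolding d_def using n ee by algebra
  have "(x $ 1 / d)\<^sup>2 + (x $ 2 / d)\<^sup>2 = ((x $ 1)\<^sup>2 + (x $ 2)\<^sup>2) / d\<^sup>2"
    by (simp add: power_divide add_divide_distrib)
  also have "\<dots> = 2 / d - 1"
    unfolding sq using d by (simp add: field_simps power2_eq_square)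
  finally have s: "(x $ 1 / d)\<^sup>2 + (x $ 2 / d)\<^sup>2 = 2 / d - 1" .
  have z: "e * (1 - d) = x $ 3" unfolding d_def using ee by algebra
  have *: "2 * (t / d) / (2 / d) = t" "e * (2 / d - 2) / (2 / d) = x $ 3" for t
    using d by (simp_all add: z[symmetric] field_simps)
  have "stereo e (x $ 1 / d) (x $ 2 / d) $ i = x $ i" for i
    using exhaust_3[of i] * by (auto simp: stereo_nth s simp del: times_divide_eq_right)
  then show ?thesis by (simp add: vec_eq_iff d_def)
qed

lemma region_atlas_open: "open I \<Longrightarrow> (U, X) \<in> region_atlas I \<Longrightarrow> open U"
proof -
  assume I: "open I" and "(U, X) \<in> region_atlas I"
  then have "U = (\<lambda>x. x $ 3) -` I" by (auto simp: region_atlas_def)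
  then show "open U" using I by (simp add: open_vimage_vec_nth)
qed

lemma region_atlas_inj:
  assumes "(U, X) \<in> region_atlas I"
  shows "inj_on X U"
proof (rule inj_onI)
  fix x y :: "real^5"
  assume eq: "X x = X y"
  obtain e d where X: "X = stereo_param e d" and e: "e \<in> {1, -1}" and d: "d \<in> {1, -1}"
    using assms by (auto simp: region_atlas_def)
  have s: "stereo e (x $ 1) (x $ 2) = stereo e (y $ 1) (y $ 2)" "x $ 3 = y $ 3"
    "stereo d (x $ 4) (x $ 5) = stereo d (y $ 4) (y $ 5)"
    using eq by (auto simp: X stereo_param_def)
  have c: "x $ 1 = y $ 1" "x $ 2 = y $ 2" "x $ 4 = y $ 4" "x $ 5 = y $ 5"
    using stereo_inverse[OF e, of "x $ 1" "x $ 2"] stereo_inverse[OF e, of "y $ 1" "y $ 2"]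
      stereo_inverse[OF d, of "x $ 4" "x $ 5"] stereo_inverse[OF d, of "y $ 4" "y $ 5"]
    by (simp_all only: s)
  have ex: "i = 1 \<or> i = 2 \<or> i = 3 \<or> i = 4 \<or> i = 5" for i :: 5
  proof (induct i)
    case (of_int z)
    then have "z = 0 \<or> z = 1 \<or> z = 2 \<or> z = 3 \<or> z = 4" by simp arith
    then show ?case by auto
  qed
  have "x $ i = y $ i" for i using ex[of i] c s(2) by auto
  then show "x = y" by (simp add: vec_eq_iff)
qed

lemma region_atlas_covers: "(\<Union>(U, X)\<in>region_atlas I. X ` U) = region I"
proof (intro equalityI subsetI)
  fix p assume "p \<in> (\<Union>(U, X)\<in>region_atlas I. X ` U)"
  then show "p \<in> region I"
    unfolding region_atlas_def region_def stereo_param_def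
    using stereo_in_sphere[of 1] stereo_in_sphere[of "-1"] by auto
next
  fix p assume "p \<in> region I"
  then obtain x r y where p: "p = (x, r, y)" and x: "x \<in> sphere 0 1" and r: "r \<in> I"
    and y: "y \<in> sphere 0 1" by (auto simp: region_def)
  have ex: "\<exists>e\<in>{1, -1}. \<exists>u v. stereo e u v = x" if x: "x \<in> sphere 0 1" for x
  proof -
    define e :: real where "e = (if x $ 3 = 1 then -1 else 1)"
    have "e \<in> {1, -1}" "e * x $ 3 \<noteq> 1" by (simp_all add: e_def)
    then show ?thesis using stereo_surj[OF x] by blast
  qed
  obtain e u v where e: "e \<in> {1, -1}" "stereo e u v = x" using ex[OF x] by blast
  obtain d s t where d: "d \<in> {1, -1}" "stereo d s t = y" using ex[OF y] by blast
  define w :: "real^5" where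
    "w = (\<chi> i. if i = 1 then u else if i = 2 then v else if i = 3 then r else if i = 4 then s else t)"
  have "stereo_param e d w = p" "w $ 3 \<in> I"
    using e d r by (simp_all add: p stereo_param_def w_def)
  then show "p \<in> (\<Union>(U, X)\<in>region_atlas I. X ` U)"
    unfolding region_atlas_def using e(1) d(1) by blast
qed

end

theory Submission
  imports Defs
begin

text \<open>Write \<open>a\<close> and \<open>b\<close> for the two warping functions, so that \<open>a' = b\<close>, \<open>b' = \<sigma> a\<close> and
  \<open>b\<^sup>2 = 1 + \<sigma> a\<^sup>2\<close> with \<open>\<sigma> = -1\<close> on the sphere and \<open>\<sigma> = 1\<close> in the hyperbolic case. For two-dimensional
  spheres the volume density is the square of \<open>w = a b\<close>, and \<open>w'' = 4 \<sigma> w\<close>. The substitution \<open>f = h / w\<close>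
  therefore turns the Laplacian of a function \<open>f(r) s(\<theta>)\<close>, where \<open>s\<close> is an eigenfunction of the first
  sphere with eigenvalue \<open>c\<close>, into a Schroedinger operator acting on the profile \<open>h\<close>
  (\<open>laplacian_separated\<close>):

    \<open>\<Delta>((h / w) s) = ((h'' - 4 \<sigma> h + c h / a\<^sup>2) / w) s\<close>.

  Multiplying a harmonic function of this form by \<open>r\<close> gives a function with Laplacian \<open>(2 h' / w) s\<close>
  (\<open>laplacian_times_r\<close>), so \<open>r F\<close> is biharmonic exactly if \<open>h'\<close> solves the same equation as \<open>h\<close>.

  Radial functions have \<open>c = 0\<close>. The equation then has constant coefficients and passes to the
  derivative; moreover \<open>h' = 0\<close> would force \<open>h = h'' / (4 \<sigma>) = 0\<close>. For \<open>c \<noteq> 0\<close> the coefficient \<open>c / a\<^sup>2\<close>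
  depends on \<open>r\<close>. With the linear function \<open>s = \<theta>\<^sub>1\<close>, of eigenvalue \<open>-2\<close>, the profile \<open>h = a\<^sup>2\<close> yields the
  harmonic function \<open>F = (a / b) \<theta>\<^sub>1\<close>, for which \<open>\<Delta>(r F) = 4 \<theta>\<^sub>1\<close> is not harmonic.

  The formula for the Laplacian is derived in the stereographic charts, which are orthogonal
  coordinates (\<open>local_laplacian_orthogonal\<close>, \<open>metric_matrix_stereo_param\<close>). Smoothness is handled
  by coinduction (\<open>smooth_on_coinduct\<close>).\<close>

section \<open>Partial derivatives and smoothness\<close>

lemma partial_cong:
  assumes "open U" "x \<in> U" "\<And>y. y \<in> U \<Longrightarrow> f y = g y"
  shows "partial i f x = partial i g x"
proof -
  have "((\<lambda>t. x + t *\<^sub>R axis i 1) \<longlongrightarrow> x) (nhds (0::real))"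
    by (auto intro!: tendsto_eq_intros filterlim_ident)
  then have "\<forall>\<^sub>F t in nhds 0. x + t *\<^sub>R axis i 1 \<in> U"
    using assms(1,2) by (rule topological_tendstoD)
  then have "\<forall>\<^sub>F t in nhds 0. t \<in> UNIV \<longrightarrow> f (x + t *\<^sub>R axis i 1) = g (x + t *\<^sub>R axis i 1)"
    by eventually_elim (use assms(3) in auto)
  then show ?thesis
    unfolding partial_def by (rule vector_derivative_cong_eq) auto
qed

lemma foldr_partial_cong:
  assumes "open U" "\<And>y. y \<in> U \<Longrightarrow> f y = g y" "x \<in> U"
  shows "foldr partial is f x = foldr partial is g x"
  using assms(3)
  by (induction "is" arbitrary: x) (auto simp: assms(2) intro: partial_cong[OF assms(1)])

lemma differentiable_on_cong:
  assumes "f differentiable_on U" "\<And>y. y \<in> U \<Longrightarrow> f y = g y"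
  shows "g differentiable_on U"
  unfolding differentiable_on_def
proof
  fix x assume x: "x \<in> U"
  then have "f differentiable at x within U" using assms(1) by (simp add: differentiable_on_def)
  then show "g differentiable at x within U"
    by (rule differentiable_transform_within[OF _ zero_less_one x]) (rule assms(2))
qed

lemma smooth_on_imp_differentiable_on: "smooth_on U f \<Longrightarrow> f differentiable_on U"
  unfolding smooth_on_def by (metis foldr_Nil id_apply)

lemma smooth_on_partial: "smooth_on U f \<Longrightarrow> smooth_on U (partial i f)"
  unfolding smooth_on_def
proof
  fix "is" assume "\<forall>is. foldr partial is f differentiable_on U"
  then have "foldr partial (is @ [i]) f differentiable_on U" by blast
  then show "foldr partial is (partial i f) differentiable_on U" by simp
qed

text \<open>A coinduction principle: smoothness quantifies over all iterated partial derivatives, and a class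
  of differentiable functions that is closed under partial derivatives (up to equality on the open
  set) contains all the iterates of each of its members.\<close>
lemma smooth_on_coinduct:
  assumes U: "open U" and f: "P f"
    and diff: "\<And>g. P g \<Longrightarrow> g differentiable_on U"
    and step: "\<And>g i. P g \<Longrightarrow> \<exists>h. P h \<and> (\<forall>x\<in>U. partial i g x = h x)"
  shows "smooth_on U f"
proof -
  have "foldr partial is g differentiable_on U" if "P g" for "is" g
    using that
  proof (induction "is" arbitrary: g rule: rev_induct)
    case Nil
    then show ?case by (simp add: diff)
  next
    case (snoc i "is")
    then obtain h where h: "P h" "\<And>x. x \<in> U \<Longrightarrow> h x = partial i g x"
      using step by metis
    have "foldr partial is (partial i g) differentiable_on U"
      by (rule differentiable_on_cong[OF snoc.IH[OF h(1)]]) (rule foldr_partial_cong[OF U h(2)])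
    then show ?case by simp
  qed
  then show ?thesis using f by (simp add: smooth_on_def)
qed

lemma has_vector_derivative_partial:
  assumes "f differentiable (at x)"
  shows "((\<lambda>t. f (x + t *\<^sub>R axis i 1)) has_vector_derivative partial i f x) (at 0)"
proof -
  obtain f' where f': "(f has_derivative f') (at x)" using assms by (auto simp: differentiable_def)
  have "((\<lambda>t. x + t *\<^sub>R axis i 1) has_derivative (\<lambda>t. t *\<^sub>R axis i 1)) (at (0::real))"
    by (auto intro!: derivative_eq_intros)
  then have "((\<lambda>t. f (x + t *\<^sub>R axis i 1)) has_derivative (\<lambda>t. f' (t *\<^sub>R axis i 1))) (at 0)"
    by (rule has_derivative_compose) (use f' in simp)
  then have "(\<lambda>t. f (x + t *\<^sub>R axis i 1)) differentiable (at 0)" by (auto simp: differentiable_def)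
  then show ?thesis
    unfolding partial_def by (simp add: vector_derivative_works)
qed

lemma partial_eqI: "((\<lambda>t. f (x + t *\<^sub>R axis i 1)) has_vector_derivative D) (at 0) \<Longrightarrow> partial i f x = D"
  unfolding partial_def by (rule vector_derivative_at)

text \<open>A partial derivative is the ordinary derivative in one coordinate, the others being held fixed.
  This is how the concrete partial derivatives are computed with one-variable rules.\<close>
lemma partial_coordI:
  assumes "((\<lambda>s. f (\<chi> j. if j = i then s else x $ j)) has_vector_derivative D) (at (x $ i))"
  shows "partial i f x = D"
proof (rule partial_eqI)
  have "((\<lambda>t. x $ i + t) has_vector_derivative 1) (at 0)"
    by (auto intro!: derivative_eq_intros)
  then have "((\<lambda>s. f (\<chi> j. if j = i then s else x $ j)) \<circ> (\<lambda>t. x $ i + t) has_vector_derivative 1 *\<^sub>R D) (at 0)"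
    by (rule vector_diff_chain_at) (use assms in simp)
  moreover have "(\<chi> j. if j = i then x $ i + t else x $ j) = x + t *\<^sub>R axis i 1" for t
    by (simp add: vec_eq_iff axis_def)
  ultimately show "((\<lambda>t. f (x + t *\<^sub>R axis i 1)) has_vector_derivative D) (at 0)"
    by (simp add: o_def)
qed

text \<open>Closure of the smooth functions under the field operations. Sums, products and reciprocals are
  taken together because the Leibniz and quotient rules mix them; their joint closure contains the
  partial derivatives of its members, so coinduction proves them smooth all at once.\<close>
inductive smooth_algebra :: "(real^'n::finite) set \<Rightarrow> (real^'n \<Rightarrow> real) \<Rightarrow> bool" for U where
  base: "smooth_on U f \<Longrightarrow> smooth_algebra U f"
| add: "smooth_algebra U f \<Longrightarrow> smooth_algebra U g \<Longrightarrow> smooth_algebra U (\<lambda>x. f x + g x)"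
| mult: "smooth_algebra U f \<Longrightarrow> smooth_algebra U g \<Longrightarrow> smooth_algebra U (\<lambda>x. f x * g x)"
| inverse: "smooth_algebra U f \<Longrightarrow> \<forall>x\<in>U. f x \<noteq> 0 \<Longrightarrow> smooth_algebra U (\<lambda>x. inverse (f x))"

lemma smooth_on_const: "smooth_on U (\<lambda>x. c)"
proof -
  have eq: "foldr partial is (\<lambda>x. c) = (\<lambda>x. if is = [] then c else 0)" for "is"
    by (induction "is") (auto simp: partial_def)
  have "foldr partial is (\<lambda>x. c) differentiable_on U" for "is"
    unfolding eq by (cases "is = []") simp_all
  then show ?thesis by (simp add: smooth_on_def)
qed

lemma smooth_algebra_differentiable_on:
  assumes "smooth_algebra U f"
  shows "f differentiable_on U"
  using assms
  by induction (auto simp: differentiable_on_def smooth_on_imp_differentiable_on[unfolded differentiable_on_def])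

lemma smooth_algebra_partial:
  assumes U: "open U" and "smooth_algebra U f"
  shows "\<exists>h. smooth_algebra U h \<and> (\<forall>x\<in>U. partial i f x = h x)"
  using assms(2)
proof induction
  case (base f)
  then show ?case using smooth_algebra.base smooth_on_partial by blast
next
  case (add f g)
  from add.IH obtain h k where hk: "smooth_algebra U h" "\<forall>x\<in>U. partial i f x = h x"
    "smooth_algebra U k" "\<forall>x\<in>U. partial i g x = k x" by metis
  have "partial i (\<lambda>x. f x + g x) x = h x + k x" if x: "x \<in> U" for x
  proof -
    have "f differentiable at x" "g differentiable at x"
      using add.hyps[THEN smooth_algebra_differentiable_on] x
      by (simp_all add: differentiable_on_eq_differentiable_at[OF U])
    from this[THEN has_vector_derivative_partial, of i] show ?thesis
      using hk x by (auto intro!: partial_eqI derivative_eq_intros)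
  qed
  then show ?case
    using smooth_algebra.add[OF hk(1,3)] by (intro exI conjI ballI)
next
  case (mult f g)
  from mult.IH obtain h k where hk: "smooth_algebra U h" "\<forall>x\<in>U. partial i f x = h x"
    "smooth_algebra U k" "\<forall>x\<in>U. partial i g x = k x" by metis
  have "partial i (\<lambda>x. f x * g x) x = f x * k x + h x * g x" if x: "x \<in> U" for x
  proof -
    have "f differentiable at x" "g differentiable at x"
      using mult.hyps[THEN smooth_algebra_differentiable_on] x
      by (simp_all add: differentiable_on_eq_differentiable_at[OF U])
    from this[THEN has_vector_derivative_partial, of i] show ?thesis
      using hk x by (auto intro!: partial_eqI derivative_eq_intros)
  qed
  moreover have "smooth_algebra U (\<lambda>x. f x * k x + h x * g x)"
    using hk mult.hyps by (intro smooth_algebra.add smooth_algebra.mult)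
  ultimately show ?case by (intro exI conjI ballI)
next
  case (inverse f)
  from inverse.IH obtain h where h: "smooth_algebra U h" "\<forall>x\<in>U. partial i f x = h x" by metis
  have "partial i (\<lambda>x. inverse (f x)) x = - 1 * (inverse (f x) * h x * inverse (f x))" if x: "x \<in> U" for x
  proof -
    have "f differentiable at x"
      using inverse.hyps(1)[THEN smooth_algebra_differentiable_on] x
      by (simp add: differentiable_on_eq_differentiable_at[OF U])
    from this[THEN has_vector_derivative_partial, of i] 
    have "((\<lambda>t. f (x + t *\<^sub>R axis i 1)) has_real_derivative h x) (at 0)"
      using h x by (simp add: has_real_derivative_iff_has_vector_derivative)
    then have "((\<lambda>t. inverse (f (x + t *\<^sub>R axis i 1))) has_real_derivative - 1 * (inverse (f x) * h x * inverse (f x))) (at 0)"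
      using inverse.hyps(2) x by (auto intro!: derivative_eq_intros)
    then show ?thesis
      by (intro partial_eqI) (simp add: has_real_derivative_iff_has_vector_derivative)
  qed
  moreover have "smooth_algebra U (\<lambda>x. - 1 * (inverse (f x) * h x * inverse (f x)))"
    using h inverse.hyps
    by (intro smooth_algebra.mult smooth_algebra.inverse smooth_algebra.base[OF smooth_on_const])
  ultimately show ?case by (intro exI conjI ballI)
qed

lemma smooth_algebra_smooth_on:
  assumes "open U" "smooth_algebra U f"
  shows "smooth_on U f"
  using assms smooth_algebra_differentiable_on smooth_algebra_partial[OF assms(1)]
  by (intro smooth_on_coinduct[where P = "smooth_algebra U"]) auto

lemma smooth_on_nth:
  assumes "open U" shows "smooth_on U (\<lambda>x. x $ k :: real)"
proof (rule smooth_on_coinduct[OF assms, where P = "\<lambda>g. (\<exists>c. g = (\<lambda>x. c)) \<or> g = (\<lambda>x. x $ k)"])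
  fix g :: "real^'a \<Rightarrow> real" and i
  assume g: "(\<exists>c. g = (\<lambda>x. c)) \<or> g = (\<lambda>x. x $ k)"
  show "g differentiable_on U"
    using g by (auto intro: bounded_linear_imp_differentiable_on bounded_linear_vec_nth)
  have "partial i (\<lambda>x. x $ k :: real) x = (if k = i then 1 else 0)" for x
    by (rule partial_coordI) simp
  with g show "\<exists>h. ((\<exists>c. h = (\<lambda>x. c)) \<or> h = (\<lambda>x. x $ k)) \<and> (\<forall>x\<in>U. partial i g x = h x)"
    by (auto simp: partial_def)
qed simp

text \<open>The combinations \<open>c a + d b\<close> form a class closed under differentiation, so \<open>sin\<close> and \<open>cos\<close>, or
  \<open>sinh\<close> and \<open>cosh\<close>, are treated at once.\<close>
lemma smooth_on_pair:
  fixes a b :: "real \<Rightarrow> real"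
  assumes U: "open U" and a: "\<And>r. (a has_real_derivative b r) (at r)"
    and b: "\<And>r. (b has_real_derivative \<sigma> * a r) (at r)"
  shows "smooth_on U (\<lambda>x. a (x $ k))" "smooth_on U (\<lambda>x. b (x $ k))"
proof -
  let ?P = "\<lambda>g. \<exists>c d. g = (\<lambda>x::real^'a. c * a (x $ k) + d * b (x $ k))"
  have "smooth_on U g" if "?P g" for g
  proof (rule smooth_on_coinduct[OF U, where P = ?P])
    fix g i assume "?P g"
    then obtain c d where g: "g = (\<lambda>x::real^'a. c * a (x $ k) + d * b (x $ k))" by blast
    have nth: "(\<lambda>x::real^'a. x $ k) differentiable at x within U" for x
      by (simp add: bounded_linear_imp_differentiable bounded_linear_vec_nth)
    have "a differentiable at r" "b differentiable at r" for r
      using a b real_differentiable_def by blast+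
    then have "(\<lambda>x::real^'a. a (x $ k)) differentiable at x within U"
      "(\<lambda>x::real^'a. b (x $ k)) differentiable at x within U" for x
      using nth by (simp_all add: differentiable_compose[of a] differentiable_compose[of b])
    then show "g differentiable_on U" by (auto simp: g differentiable_on_def)
    have "partial i g x = (if i = k then d * \<sigma> else 0) * a (x $ k) + (if i = k then c else 0) * b (x $ k)" for x
    proof (rule partial_coordI)
      show "((\<lambda>s. g (\<chi> j. if j = i then s else x $ j)) has_vector_derivative
         (if i = k then d * \<sigma> else 0) * a (x $ k) + (if i = k then c else 0) * b (x $ k)) (at (x $ i))"
        unfolding g has_real_derivative_iff_has_vector_derivative[symmetric]
        by (auto intro!: derivative_eq_intros a b)
    qed
    then show "\<exists>h. ?P h \<and> (\<forall>x\<in>U. partial i g x = h x)" by metis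
  qed (fact that)
  note smooth = this
  show "smooth_on U (\<lambda>x. a (x $ k))"
    by (rule smooth, rule exI[of _ 1], rule exI[of _ 0]) simp
  show "smooth_on U (\<lambda>x. b (x $ k))"
    by (rule smooth, rule exI[of _ 0], rule exI[of _ 1]) simp
qed

section \<open>The Laplacian in orthogonal coordinates\<close>

lemma matrix_inv_diagonal:
  fixes m :: "'n::finite \<Rightarrow> real"
  assumes "\<And>i. m i \<noteq> 0"
  shows "matrix_inv (\<chi> i j. if i = j then m i else 0) = (\<chi> i j. if i = j then inverse (m i) else 0)"
    (is "matrix_inv ?A = ?B")
proof -
  have AB: "?A ** ?B = mat 1" "?B ** ?A = mat 1"
    using assms by (auto simp: matrix_matrix_mult_def mat_def vec_eq_iff if_distrib[of "\<lambda>x. x * _"] cong: if_cong)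
  have "?A ** matrix_inv ?A = mat 1 \<and> matrix_inv ?A ** ?A = mat 1"
    unfolding matrix_inv_def by (rule someI[where x = ?B]) (use AB in simp)
  then have "?B ** (?A ** matrix_inv ?A) = ?B" by simp
  then show ?thesis by (simp add: matrix_mul_assoc AB)
qed

lemma local_laplacian_orthogonal:
  fixes m :: "real^'n::finite \<Rightarrow> 'n \<Rightarrow> real"
  assumes U: "open U" "x \<in> U"
    and m: "\<And>y. y \<in> U \<Longrightarrow> metric_matrix g X y = (\<chi> i j. if i = j then m y i else 0)"
    and pos: "\<And>y i. y \<in> U \<Longrightarrow> m y i > 0"
  shows "local_laplacian g X f x =
    (\<Sum>i\<in>UNIV. partial i (\<lambda>y. sqrt (\<Prod>j\<in>UNIV. m y j) * (partial i f y / m y i)) x)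
      / sqrt (\<Prod>j\<in>UNIV. m x j)"
proof -
  have det: "det (metric_matrix g X y) = (\<Prod>j\<in>UNIV. m y j)" if "y \<in> U" for y
    unfolding m[OF that] by (subst det_diagonal) auto
  have grad: "local_grad g X f y $ i = partial i f y / m y i" if "y \<in> U" for y i
    unfolding local_grad_def m[OF that] 
    by (subst matrix_inv_diagonal)
      (use pos[OF that] in \<open>auto simp: less_imp_neq[symmetric] matrix_vector_mult_def if_distrib[of "\<lambda>x. x * _"] divide_inverse cong: if_cong\<close>)
  show ?thesis
    unfolding local_laplacian_def local_div_def
    by (intro arg_cong2[where f = "(/)"] sum.cong refl partial_cong[OF U]) (simp_all add: det grad U)
qed

section \<open>Stereographic coordinates\<close>

lemma exhaust_5: "i = 1 \<or> i = 2 \<or> i = 3 \<or> i = 4 \<or> i = 5" for i :: 5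
proof (induct i)
  case (of_int z)
  then have "z = 0 \<or> z = 1 \<or> z = 2 \<or> z = 3 \<or> z = 4" by simp arith
  then show ?case by auto
qed

lemma UNIV_5: "UNIV = {1, 2, 3, 4, 5::5}"
  using exhaust_5 by auto

lemma sum_5: "sum f (UNIV :: 5 set) = f 1 + f 2 + f 3 + f 4 + f 5"
  unfolding UNIV_5 by (simp add: ac_simps)

lemma has_vector_derivative_vector_3:
  assumes "(p has_real_derivative p') (at t)" "(q has_real_derivative q') (at t)"
    "(s has_real_derivative s') (at t)"
  shows "((\<lambda>t. vector [p t, q t, s t] :: real^3) has_vector_derivative vector [p', q', s']) (at t)"
proof -
  have v: "vector [x, y, z] = x *\<^sub>R axis 1 1 + y *\<^sub>R axis 2 1 + z *\<^sub>R (axis 3 1 :: real^3)" for x y z :: real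
    by (simp add: vec_eq_iff forall_3 axis_def)
  show ?thesis
    unfolding v using assms by (auto intro!: derivative_eq_intros)
qed

lemma stereo_eq: "stereo e u v = vector [2 * u / (u\<^sup>2 + v\<^sup>2 + 1), 2 * v / (u\<^sup>2 + v\<^sup>2 + 1),
    e * (u\<^sup>2 + v\<^sup>2 - 1) / (u\<^sup>2 + v\<^sup>2 + 1)]"
  by (simp add: vec_eq_iff forall_3 stereo_nth)

lemma sphere_factor_pos: "u\<^sup>2 + v\<^sup>2 + 1 > (0::real)"
  by (simp add: add_nonneg_pos)

definition stereo_du :: "real \<Rightarrow> real \<Rightarrow> real \<Rightarrow> real^3" where
  "stereo_du e u v = (2 / (u\<^sup>2 + v\<^sup>2 + 1)\<^sup>2) *\<^sub>R vector [v\<^sup>2 + 1 - u\<^sup>2, - 2 * u * v, 2 * e * u]"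

definition stereo_dv :: "real \<Rightarrow> real \<Rightarrow> real \<Rightarrow> real^3" where
  "stereo_dv e u v = (2 / (u\<^sup>2 + v\<^sup>2 + 1)\<^sup>2) *\<^sub>R vector [- 2 * u * v, u\<^sup>2 + 1 - v\<^sup>2, 2 * e * v]"

lemma scaleR_vector_3: "c *\<^sub>R (vector [x, y, z] :: real^3) = vector [c * x, c * y, c * z]"
  by (simp add: vec_eq_iff forall_3)

lemma stereo_deriv_u: "((\<lambda>u. stereo e u v) has_vector_derivative stereo_du e u v) (at u)"
proof -
  have p: "u\<^sup>2 + v\<^sup>2 + 1 \<noteq> 0" using sphere_factor_pos[of u v] by simp
  show ?thesis
    unfolding stereo_eq stereo_du_def scaleR_vector_3
    by (rule has_vector_derivative_vector_3; (rule derivative_eq_intros refl p)+;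
        use p in \<open>simp add: divide_simps power2_eq_square\<close>; simp add: algebra_simps power2_eq_square)
qed

lemma stereo_deriv_v: "((\<lambda>v. stereo e u v) has_vector_derivative stereo_dv e u v) (at v)"
proof -
  have p: "u\<^sup>2 + v\<^sup>2 + 1 \<noteq> 0" using sphere_factor_pos[of u v] by simp
  show ?thesis
    unfolding stereo_eq stereo_dv_def scaleR_vector_3
    by (rule has_vector_derivative_vector_3; (rule derivative_eq_intros refl p)+;
        use p in \<open>simp add: divide_simps power2_eq_square\<close>; simp add: algebra_simps power2_eq_square)
qed

text \<open>Stereographic projection is conformal with factor \<open>2 / (u\<^sup>2 + v\<^sup>2 + 1)\<close>. Hence the charts
  of the product are orthogonal coordinates.\<close>
lemma stereo_conformal:
  assumes "e \<in> {1, -1}"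
  shows "stereo_du e u v \<bullet> stereo_du e u v = 4 / (u\<^sup>2 + v\<^sup>2 + 1)\<^sup>2"
    and "stereo_dv e u v \<bullet> stereo_dv e u v = 4 / (u\<^sup>2 + v\<^sup>2 + 1)\<^sup>2"
    and "stereo_du e u v \<bullet> stereo_dv e u v = 0"
    and "stereo_dv e u v \<bullet> stereo_du e u v = 0"
proof -
  have p: "u\<^sup>2 + v\<^sup>2 + 1 \<noteq> 0" using sphere_factor_pos[of u v] by simp
  have ee: "e * e = 1" using assms by auto
  define \<rho> where "\<rho> = u\<^sup>2 + v\<^sup>2 + 1"
  have p: "\<rho> \<noteq> 0" using p by (simp add: \<rho>_def)
  have dot: "(c *\<^sub>R vector [x1, x2, x3]) \<bullet> (c *\<^sub>R vector [y1, y2, y3] :: real^3)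
      = c\<^sup>2 * (x1 * y1 + x2 * y2 + x3 * y3)" for c x1 x2 x3 y1 y2 y3
    by (simp add: inner_vec_def sum_3 power2_eq_square algebra_simps)
  have u: "(v\<^sup>2 + 1 - u\<^sup>2) * (v\<^sup>2 + 1 - u\<^sup>2) + - 2 * u * v * (- 2 * u * v) + 2 * e * u * (2 * e * u) = \<rho>\<^sup>2"
    and v: "- 2 * u * v * (- 2 * u * v) + (u\<^sup>2 + 1 - v\<^sup>2) * (u\<^sup>2 + 1 - v\<^sup>2) + 2 * e * v * (2 * e * v) = \<rho>\<^sup>2"
    and uv: "(v\<^sup>2 + 1 - u\<^sup>2) * (- 2 * u * v) + - 2 * u * v * (u\<^sup>2 + 1 - v\<^sup>2) + 2 * e * u * (2 * e * v) = 0"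
    unfolding \<rho>_def using ee by algebra+
  have s: "(2 / \<rho>\<^sup>2)\<^sup>2 * \<rho>\<^sup>2 = 4 / \<rho>\<^sup>2"
    using p by (simp add: field_simps power2_eq_square)
  show "stereo_du e u v \<bullet> stereo_du e u v = 4 / (u\<^sup>2 + v\<^sup>2 + 1)\<^sup>2"
    and "stereo_dv e u v \<bullet> stereo_dv e u v = 4 / (u\<^sup>2 + v\<^sup>2 + 1)\<^sup>2"
    unfolding stereo_du_def stereo_dv_def dot u v \<rho>_def[symmetric] by (fact s)+
  show "stereo_du e u v \<bullet> stereo_dv e u v = 0"
    unfolding stereo_du_def stereo_dv_def dot uv by simp
  then show "stereo_dv e u v \<bullet> stereo_du e u v = 0" by (simp add: inner_commute)
qed

lemma partial_stereo_param:
  "partial 1 (stereo_param e d) x = (stereo_du e (x $ 1) (x $ 2), 0, 0)"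
  "partial 2 (stereo_param e d) x = (stereo_dv e (x $ 1) (x $ 2), 0, 0)"
  "partial 3 (stereo_param e d) x = (0, 1, 0)"
  "partial 4 (stereo_param e d) x = (0, 0, stereo_du d (x $ 4) (x $ 5))"
  "partial 5 (stereo_param e d) x = (0, 0, stereo_dv d (x $ 4) (x $ 5))"
  by (rule partial_coordI;
      auto simp: stereo_param_def intro!: has_vector_derivative_Pair stereo_deriv_u stereo_deriv_v)+

definition chart_metric :: "(real \<Rightarrow> real) \<Rightarrow> (real \<Rightarrow> real) \<Rightarrow> real^5 \<Rightarrow> 5 \<Rightarrow> real" where
  "chart_metric a b x i =
    (if i \<in> {1, 2} then 4 * (a (x $ 3))\<^sup>2 / ((x $ 1)\<^sup>2 + (x $ 2)\<^sup>2 + 1)\<^sup>2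
     else if i = 3 then 1
     else 4 * (b (x $ 3))\<^sup>2 / ((x $ 4)\<^sup>2 + (x $ 5)\<^sup>2 + 1)\<^sup>2)"

lemma metric_matrix_stereo_param:
  assumes "e \<in> {1, -1}" "d \<in> {1, -1}"
  shows "metric_matrix (warped_metric a b) (stereo_param e d) x =
    (\<chi> i j. if i = j then chart_metric a b x i else 0)"
proof -
  have "warped_metric a b (stereo_param e d x) (partial i (stereo_param e d) x) (partial j (stereo_param e d) x)
      = (if i = j then chart_metric a b x i else 0)" for i j
  proof -
    note eqs = stereo_param_def[of e d x] partial_stereo_param stereo_conformal[OF assms(1)]
      stereo_conformal[OF assms(2)] chart_metric_def
    consider "i = 1" | "i = 2" | "i = 3" | "i = 4" | "i = 5" using exhaust_5[of i] by blast
    then show ?thesis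
      using exhaust_5[of j] by cases (elim disjE; simp add: eqs)+
  qed
  then show ?thesis by (simp add: metric_matrix_def)
qed

text \<open>Eigenfunctions of the Laplacian of the round two-sphere with eigenvalue \<open>c\<close>, expressed in the
  stereographic charts: there the metric is \<open>4 / (u\<^sup>2 + v\<^sup>2 + 1)\<^sup>2\<close> times the Euclidean one, and in dimension two
  a conformal factor only divides the flat Laplacian. The derivatives are part of the definition,
  since they are what the computation of the Laplacian on the product consumes.\<close>
definition sphere_eigenfunction :: "real \<Rightarrow> (real^3 \<Rightarrow> real) \<Rightarrow> bool" where
  "sphere_eigenfunction c s \<longleftrightarrow> (\<forall>e\<in>{1, -1}. \<exists>Su Suu Sv Svv. \<forall>u v.
    ((\<lambda>u. s (stereo e u v)) has_real_derivative Su u v) (at u) \<and>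
    ((\<lambda>u. Su u v) has_real_derivative Suu u v) (at u) \<and>
    ((\<lambda>v. s (stereo e u v)) has_real_derivative Sv u v) (at v) \<and>
    ((\<lambda>v. Sv u v) has_real_derivative Svv u v) (at v) \<and>
    (u\<^sup>2 + v\<^sup>2 + 1)\<^sup>2 / 4 * (Suu u v + Svv u v) = c * s (stereo e u v))"

lemma sphere_eigenfunction_const: "sphere_eigenfunction 0 (\<lambda>_. k)"
  unfolding sphere_eigenfunction_def
  by (intro ballI exI[of _ "\<lambda>_ _. 0"]) auto

text \<open>Linear functions are the spherical harmonics of degree \<open>l = 1\<close>, with eigenvalue \<open>- l (l + 1)\<close>.\<close>
lemma sphere_eigenfunction_nth: "sphere_eigenfunction (-2) (\<lambda>\<theta>. \<theta> $ 1)"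
  unfolding sphere_eigenfunction_def stereo_nth
proof (intro ballI exI allI conjI)
  fix e u v :: real
  define R where "R u v = u\<^sup>2 + v\<^sup>2 + 1" for u v :: real
  have p: "R u v \<noteq> 0" using sphere_factor_pos[of u v] by (simp add: R_def)
  have Ru: "((\<lambda>u. R u v) has_real_derivative 2 * u) (at u)"
    and Rv: "((\<lambda>v. R u v) has_real_derivative 2 * v) (at v)"
    unfolding R_def by (auto intro!: derivative_eq_intros)
  show "((\<lambda>u. 2 * u / (u\<^sup>2 + v\<^sup>2 + 1)) has_real_derivative 2 / R u v - 4 * u\<^sup>2 / (R u v)\<^sup>2) (at u)"
    unfolding R_def[symmetric]
    by (rule derivative_eq_intros Ru refl p)+ (use p in \<open>simp add: field_simps power2_eq_square\<close>)
  show "((\<lambda>u. 2 / R u v - 4 * u\<^sup>2 / (R u v)\<^sup>2) has_real_derivative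
      16 * u ^ 3 / R u v ^ 3 - 12 * u / (R u v)\<^sup>2) (at u)"
    using p by (auto intro!: derivative_eq_intros Ru)
      (simp add: field_simps eval_nat_numeral)
  show "((\<lambda>v. 2 * u / (u\<^sup>2 + v\<^sup>2 + 1)) has_real_derivative - (4 * u * v) / (R u v)\<^sup>2) (at v)"
    unfolding R_def[symmetric]
    by (rule derivative_eq_intros Rv refl p)+ (use p in \<open>simp add: field_simps power2_eq_square\<close>)
  show "((\<lambda>v. - (4 * u * v) / (R u v)\<^sup>2) has_real_derivative
      16 * u * v\<^sup>2 / R u v ^ 3 - 4 * u / (R u v)\<^sup>2) (at v)"
    using p by (auto intro!: derivative_eq_intros Rv)
      (simp add: field_simps eval_nat_numeral)
  have uv: "u\<^sup>2 + v\<^sup>2 = R u v - 1" by (simp add: R_def)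
  have "(R u v)\<^sup>2 / 4 * (16 * u ^ 3 / R u v ^ 3 - 12 * u / (R u v)\<^sup>2 +
      (16 * u * v\<^sup>2 / R u v ^ 3 - 4 * u / (R u v)\<^sup>2)) = 4 * u * (u\<^sup>2 + v\<^sup>2) / R u v - 4 * u"
    using p by (simp add: field_simps power2_eq_square power3_eq_cube)
  also have "\<dots> = - 2 * (2 * u / R u v)"
    unfolding uv using p by (simp add: field_simps)
  finally show "(u\<^sup>2 + v\<^sup>2 + 1)\<^sup>2 / 4 * (16 * u ^ 3 / R u v ^ 3 - 12 * u / (R u v)\<^sup>2 +
      (16 * u * v\<^sup>2 / R u v ^ 3 - 4 * u / (R u v)\<^sup>2)) = - 2 * (2 * u / (u\<^sup>2 + v\<^sup>2 + 1))"
    unfolding R_def .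
qed

section \<open>Smooth functions on the region\<close>

lemma smooth_times_r:
  assumes "open I" "smooth I F"
  shows "smooth I (times_r F)"
  unfolding smooth_def
proof safe
  fix U X assume UX: "(U, X) \<in> region_atlas I"
  then have U: "open U" and F: "smooth_on U (F \<circ> X)"
    using region_atlas_open assms by (auto simp: smooth_def)
  have "smooth_on U (\<lambda>x. x $ 3 * (F \<circ> X) x)"
    by (rule smooth_algebra_smooth_on[OF U], rule smooth_algebra.mult;
        rule smooth_algebra.base, intro smooth_on_nth[OF U] F)
  moreover have "times_r F \<circ> X = (\<lambda>x. x $ 3 * (F \<circ> X) x)"
    using UX by (auto simp: region_atlas_def times_r_def stereo_param_def)
  ultimately show "smooth_on U (times_r F \<circ> X)" by simp
qed

text \<open>A smooth radial function has a twice differentiable profile: restrict it, in one chart, to the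
  line along the third coordinate. Then its derivatives are iterated partial derivatives of the chart
  expression.\<close>
lemma radial_profile:
  assumes I: "open I" and F: "smooth I F" "radial I F"
  obtains f f' f'' where
    "\<And>r. r \<in> I \<Longrightarrow> (f has_real_derivative f' r) (at r)"
    "\<And>r. r \<in> I \<Longrightarrow> (f' has_real_derivative f'' r) (at r)"
    "\<And>\<theta> r \<phi>. (\<theta>, r, \<phi>) \<in> region I \<Longrightarrow> F (\<theta>, r, \<phi>) = f r"
proof -
  let ?U = "{x::real^5. x $ 3 \<in> I}" and ?X = "stereo_param 1 1"
  let ?G = "F \<circ> ?X"
  let ?y = "\<lambda>r. r *\<^sub>R axis 3 1 :: real^5"
  have UX: "(?U, ?X) \<in> region_atlas I" by (auto simp: region_atlas_def)
  then have U: "open ?U" and G: "smooth_on ?U ?G"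
    using region_atlas_open I F(1) by (auto simp: smooth_def)
  have deriv: "((\<lambda>r. g (?y r)) has_real_derivative partial 3 g (?y r)) (at r)"
    if "smooth_on ?U g" "r \<in> I" for g r
  proof -
    have "g differentiable at (?y r)"
      using smooth_on_imp_differentiable_on[OF that(1)] that(2)
      by (simp add: differentiable_on_eq_differentiable_at[OF U])
    from has_vector_derivative_partial[OF this, of 3]
    have "((\<lambda>t. g (?y (t + r))) has_real_derivative partial 3 g (?y r)) (at 0)"
      by (simp add: has_real_derivative_iff_has_vector_derivative scaleR_add_left add.commute)
    then show ?thesis using DERIV_shift[of "\<lambda>r. g (?y r)" _ 0 r] by simp
  qed
  obtain f where f: "\<And>\<theta> r \<phi>. (\<theta>, r, \<phi>) \<in> region I \<Longrightarrow> F (\<theta>, r, \<phi>) = f r"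
    using F(2) by (fastforce simp: radial_def)
  have "F (\<theta>, r, \<phi>) = ?G (?y r)" if "(\<theta>, r, \<phi>) \<in> region I" for \<theta> r \<phi>
    using that stereo_in_sphere[of 1] by (simp add: f stereo_param_def region_def)
  then show ?thesis
    using that[of "\<lambda>r. ?G (?y r)" "\<lambda>r. partial 3 ?G (?y r)" "\<lambda>r. partial 3 (partial 3 ?G) (?y r)"]
      deriv[OF G] deriv[OF smooth_on_partial[OF G]] by blast
qed

section \<open>The Laplacian of separated functions\<close>

text \<open>The chart in which the Laplacian is evaluated is an unspecified one of the atlas. A value that
  is obtained in every chart is therefore the value of the Laplacian.\<close>
lemma laplace_beltrami_eqI:
  assumes p: "p \<in> (\<Union>(U, X)\<in>A. X ` U)" and inj: "\<And>U X. (U, X) \<in> A \<Longrightarrow> inj_on X U"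
    and L: "\<And>U X x. (U, X) \<in> A \<Longrightarrow> x \<in> U \<Longrightarrow> X x = p \<Longrightarrow> local_laplacian g X (F \<circ> X) x = L"
  shows "laplace_beltrami A g F p = L"
proof -
  let ?P = "\<lambda>(U, X). (U, X) \<in> A \<and> p \<in> X ` U"
  obtain U X where UX: "(SOME c. ?P c) = (U, X)" by fastforce
  have "\<exists>c. ?P c" using p by fastforce
  then have "?P (SOME c. ?P c)" by (rule someI_ex)
  then have c: "(U, X) \<in> A" "p \<in> X ` U" by (simp_all add: UX)
  have "the_inv_into U X p \<in> U" "X (the_inv_into U X p) = p"
    using the_inv_into_into[OF inj[OF c(1)] c(2) order_refl] f_the_inv_into_f[OF inj[OF c(1)] c(2)] by auto
  then show ?thesis
    unfolding laplace_beltrami_def UX by (simp add: L[OF c(1)])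
qed

text \<open>The common features of \<open>(sin, cos)\<close> with \<open>\<sigma> = -1\<close> and of \<open>(sinh, cosh)\<close> with \<open>\<sigma> = 1\<close>.\<close>
locale warped_pair =
  fixes I :: "real set" and a b :: "real \<Rightarrow> real" and \<sigma> :: real
  assumes open_I: "open I"
    and a_pos: "r \<in> I \<Longrightarrow> a r > 0"
    and b_pos: "r \<in> I \<Longrightarrow> b r > 0"
    and deriv_a: "(a has_real_derivative b r) (at r)"
    and deriv_b: "(b has_real_derivative \<sigma> * a r) (at r)"
    and b_squared: "(b r)\<^sup>2 = 1 + \<sigma> * (a r)\<^sup>2"
begin

text \<open>Together with the next fact: \<open>w = a b\<close> solves \<open>w'' = 4 \<sigma> w\<close>. The volume density is
  \<open>w\<^sup>2\<close>, as both spheres are two-dimensional; that its square root is an eigenfunction of the second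
  derivative is the source of all that follows.\<close>
lemma deriv_ab:
  "((\<lambda>r. a r * b r) has_real_derivative (b r)\<^sup>2 + \<sigma> * (a r)\<^sup>2) (at r)"
  by (auto intro!: derivative_eq_intros deriv_a deriv_b simp: power2_eq_square)

lemma deriv2_ab:
  "((\<lambda>r. (b r)\<^sup>2 + \<sigma> * (a r)\<^sup>2) has_real_derivative 4 * \<sigma> * (a r * b r)) (at r)"
  by (auto intro!: derivative_eq_intros deriv_a deriv_b simp: power2_eq_square)

text \<open>The radial part of the Laplacian is \<open>f'' + 2 (w' / w) f'\<close> with \<open>w = a b\<close>. Substituting \<open>f = h / w\<close>
  removes the first-order term and leaves \<open>(h'' - (w'' / w) h) / w\<close>, in which \<open>w'' / w = 4 \<sigma>\<close> is
  constant. A factor \<open>s\<close> on the first sphere, whose radius is \<open>a\<close>, contributes its eigenvalue divided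
  by \<open>a\<^sup>2\<close>.\<close>
lemma laplacian_separated:
  assumes h: "\<And>r. r \<in> I \<Longrightarrow> (h has_real_derivative h' r) (at r)"
    and h': "\<And>r. r \<in> I \<Longrightarrow> (h' has_real_derivative h'' r) (at r)"
    and s: "sphere_eigenfunction c s"
    and F: "\<And>\<theta> r \<phi>. (\<theta>, r, \<phi>) \<in> region I \<Longrightarrow> F (\<theta>, r, \<phi>) = h r / (a r * b r) * s \<theta>"
    and p: "(\<theta>, r, \<phi>) \<in> region I"
  shows "laplacian I a b F (\<theta>, r, \<phi>) = (h'' r - 4 * \<sigma> * h r + c / (a r)\<^sup>2 * h r) / (a r * b r) * s \<theta>"
  unfolding laplacian_def
proof (rule laplace_beltrami_eqI)
  show "(\<theta>, r, \<phi>) \<in> (\<Union>(U, X)\<in>region_atlas I. X ` U)" using p by (simp add: region_atlas_covers)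
next
  fix U X and x :: "real^5"
  assume UX: "(U, X) \<in> region_atlas I" and x: "x \<in> U" and Xx: "X x = (\<theta>, r, \<phi>)"
  obtain e d where X: "X = stereo_param e d" and e: "e \<in> {1, -1}" and d: "d \<in> {1, -1}"
    and U: "U = {x. x $ 3 \<in> I}"
    using UX by (auto simp: region_atlas_def)
  have U_open: "open U" using region_atlas_open[OF open_I UX] .
  let ?w = "\<lambda>r. a r * b r" and ?w' = "\<lambda>r. (b r)\<^sup>2 + \<sigma> * (a r)\<^sup>2"
  define S where "S u v = s (stereo e u v)" for u v
  obtain Su Suu Sv Svv where S_all: "\<forall>u v.
      ((\<lambda>u. S u v) has_real_derivative Su u v) (at u) \<and>
      ((\<lambda>u. Su u v) has_real_derivative Suu u v) (at u) \<and>
      ((\<lambda>v. S u v) has_real_derivative Sv u v) (at v) \<and>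
      ((\<lambda>v. Sv u v) has_real_derivative Svv u v) (at v) \<and>
      (u\<^sup>2 + v\<^sup>2 + 1)\<^sup>2 / 4 * (Suu u v + Svv u v) = c * S u v"
    using bspec[OF s[unfolded sphere_eigenfunction_def] e] unfolding S_def[symmetric]
    by (elim exE) (rule that)
  have S: "((\<lambda>u. S u v) has_real_derivative Su u v) (at u)"
    "((\<lambda>u. Su u v) has_real_derivative Suu u v) (at u)"
    "((\<lambda>v. S u v) has_real_derivative Sv u v) (at v)"
    "((\<lambda>v. Sv u v) has_real_derivative Svv u v) (at v)"
    and eig: "(u\<^sup>2 + v\<^sup>2 + 1)\<^sup>2 / 4 * (Suu u v + Svv u v) = c * S u v" for u v
    using S_all by simp_all
  define \<rho> where "\<rho> u v = u\<^sup>2 + v\<^sup>2 + (1::real)" for u v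
  have \<rho>: "\<rho> u v > 0" for u v by (simp add: \<rho>_def sphere_factor_pos)
  let ?m = "chart_metric a b"
  let ?G = "F \<circ> X"
  have G: "?G y = h (y $ 3) / ?w (y $ 3) * S (y $ 1) (y $ 2)" if "y \<in> U" for y
    using that stereo_in_sphere[OF e] stereo_in_sphere[OF d]
    by (simp add: X stereo_param_def F region_def U S_def)
  have w: "?w (y $ 3) > 0" if "y \<in> U" for y using that a_pos b_pos by (simp add: U)
  have m_pos: "?m y i > 0" if "y \<in> U" for y i
  proof -
    have "a (y $ 3) > 0" "b (y $ 3) > 0" using that a_pos b_pos by (simp_all add: U)
    then show ?thesis using \<rho>[of "y $ 1" "y $ 2"] \<rho>[of "y $ 4" "y $ 5"]
      by (simp add: chart_metric_def \<rho>_def)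
  qed
  have vol: "sqrt (\<Prod>j\<in>UNIV. ?m y j) = 16 * (?w (y $ 3))\<^sup>2 / ((\<rho> (y $ 1) (y $ 2))\<^sup>2 * (\<rho> (y $ 4) (y $ 5))\<^sup>2)" for y
  proof -
    have m: "?m y 1 = 4 * (a (y $ 3))\<^sup>2 / (\<rho> (y $ 1) (y $ 2))\<^sup>2" "?m y 2 = ?m y 1" "?m y 3 = 1"
      "?m y 4 = 4 * (b (y $ 3))\<^sup>2 / (\<rho> (y $ 4) (y $ 5))\<^sup>2" "?m y 5 = ?m y 4"
      by (simp_all add: chart_metric_def \<rho>_def)
    have "(\<Prod>j\<in>UNIV. ?m y j) = (?m y 1 * ?m y 4)\<^sup>2"
      unfolding UNIV_5 power2_eq_square by (simp add: m(2,3,5))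
    moreover have "?m y 1 * ?m y 4 \<ge> 0"
      unfolding m by simp
    ultimately show ?thesis
      by (simp add: m power_mult_distrib)
  qed
  \<comment> \<open>The partial derivatives of the function, needed on all of \<open>U\<close> since they are differentiated again.\<close>
  have G1: "partial 1 ?G y = h (y $ 3) / ?w (y $ 3) * Su (y $ 1) (y $ 2)"
    and G2: "partial 2 ?G y = h (y $ 3) / ?w (y $ 3) * Sv (y $ 1) (y $ 2)"
    and G3: "partial 3 ?G y = (h' (y $ 3) * ?w (y $ 3) - h (y $ 3) * ?w' (y $ 3)) / (?w (y $ 3))\<^sup>2 * S (y $ 1) (y $ 2)"
    and G4: "partial 4 ?G y = 0" and G5: "partial 5 ?G y = 0"
    if y: "y \<in> U" for y
  proof -
    have wn: "?w (y $ 3) \<noteq> 0" using w[OF y] by linarith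
    have yI: "y $ 3 \<in> I" using y by (simp add: U)
    note cong = partial_cong[OF U_open y G, THEN trans]
    show "partial 1 ?G y = h (y $ 3) / ?w (y $ 3) * Su (y $ 1) (y $ 2)"
      by (rule cong, assumption, rule partial_coordI)
        (use wn in \<open>auto simp flip: has_real_derivative_iff_has_vector_derivative intro!: derivative_eq_intros S\<close>)
    show "partial 2 ?G y = h (y $ 3) / ?w (y $ 3) * Sv (y $ 1) (y $ 2)"
      by (rule cong, assumption, rule partial_coordI)
        (use wn in \<open>auto simp flip: has_real_derivative_iff_has_vector_derivative intro!: derivative_eq_intros S\<close>)
    have "((\<lambda>t. h t / ?w t) has_real_derivative (h' (y $ 3) * ?w (y $ 3) - h (y $ 3) * ?w' (y $ 3)) / (?w (y $ 3))\<^sup>2) (at (y $ 3))"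
      unfolding power2_eq_square[of "?w _"] by (rule DERIV_divide[OF h[OF yI] deriv_ab wn])
    note d = DERIV_cmult_right[OF this]
    show "partial 3 ?G y = (h' (y $ 3) * ?w (y $ 3) - h (y $ 3) * ?w' (y $ 3)) / (?w (y $ 3))\<^sup>2 * S (y $ 1) (y $ 2)"
      by (rule cong, assumption, rule partial_coordI)
        (use d in \<open>simp flip: has_real_derivative_iff_has_vector_derivative\<close>)
    show "partial 4 ?G y = 0" "partial 5 ?G y = 0"
      by (rule cong, assumption, rule partial_coordI, simp)+
  qed
  let ?V = "\<lambda>i y. sqrt (\<Prod>j\<in>UNIV. ?m y j) * (partial i ?G y / ?m y i)"
  have r: "x $ 3 = r" "r \<in> I" using x Xx by (simp_all add: X stereo_param_def U)
  have nz: "a r \<noteq> 0" "b r \<noteq> 0" "\<rho> (x $ 1) (x $ 2) \<noteq> 0" "\<rho> (x $ 4) (x $ 5) \<noteq> 0"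
    using a_pos[OF r(2)] b_pos[OF r(2)] \<rho>[of "x $ 1" "x $ 2"] \<rho>[of "x $ 4" "x $ 5"] by simp_all
  define K where "K = 16 / ((\<rho> (x $ 1) (x $ 2))\<^sup>2 * (\<rho> (x $ 4) (x $ 5))\<^sup>2)"
  \<comment> \<open>The five terms of the divergence. In the first two the factor \<open>\<rho>\<close> of the first sphere cancels
    between the volume density and the inverse metric, so only \<open>Su\<close> and \<open>Sv\<close> are differentiated.\<close>
  have V1: "partial 1 (?V 1) x = 4 * (b r)\<^sup>2 / (\<rho> (x $ 4) (x $ 5))\<^sup>2 * (h r / ?w r) * Suu (x $ 1) (x $ 2)"
  proof -
    have "?V 1 y = 4 * (b (y $ 3))\<^sup>2 / (\<rho> (y $ 4) (y $ 5))\<^sup>2 * (h (y $ 3) / ?w (y $ 3)) * Su (y $ 1) (y $ 2)"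
      if y: "y \<in> U" for y
      unfolding vol G1[OF y] using w[OF y] \<rho>[of "y $ 1" "y $ 2"] \<rho>[of "y $ 4" "y $ 5"]
      by (simp add: chart_metric_def flip: \<rho>_def) (simp add: field_simps power2_eq_square)
    note cong = partial_cong[OF U_open x this, THEN trans]
    show ?thesis
      by (rule cong, assumption, rule partial_coordI)
        (use nz in \<open>auto simp: r simp flip: has_real_derivative_iff_has_vector_derivative intro!: derivative_eq_intros S\<close>)
  qed
  have V2: "partial 2 (?V 2) x = 4 * (b r)\<^sup>2 / (\<rho> (x $ 4) (x $ 5))\<^sup>2 * (h r / ?w r) * Svv (x $ 1) (x $ 2)"
  proof -
    have "?V 2 y = 4 * (b (y $ 3))\<^sup>2 / (\<rho> (y $ 4) (y $ 5))\<^sup>2 * (h (y $ 3) / ?w (y $ 3)) * Sv (y $ 1) (y $ 2)"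
      if y: "y \<in> U" for y
      unfolding vol G2[OF y] using w[OF y] \<rho>[of "y $ 1" "y $ 2"] \<rho>[of "y $ 4" "y $ 5"]
      by (simp add: chart_metric_def flip: \<rho>_def) (simp add: field_simps power2_eq_square)
    note cong = partial_cong[OF U_open x this, THEN trans]
    show ?thesis
      by (rule cong, assumption, rule partial_coordI)
        (use nz in \<open>auto simp: r simp flip: has_real_derivative_iff_has_vector_derivative intro!: derivative_eq_intros S\<close>)
  qed
  have V3: "partial 3 (?V 3) x = K * (h'' r * ?w r - h r * (4 * \<sigma> * ?w r)) * S (x $ 1) (x $ 2)"
  proof -
    have "?V 3 y = 16 / ((\<rho> (y $ 1) (y $ 2))\<^sup>2 * (\<rho> (y $ 4) (y $ 5))\<^sup>2)
        * (h' (y $ 3) * ?w (y $ 3) - h (y $ 3) * ?w' (y $ 3)) * S (y $ 1) (y $ 2)"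
      if y: "y \<in> U" for y
      unfolding vol G3[OF y] using w[OF y, THEN less_imp_neq]
      by (simp add: chart_metric_def)
    note cong = partial_cong[OF U_open x this, THEN trans]
    have "((\<lambda>t. h' t * ?w t - h t * ?w' t) has_real_derivative h'' r * ?w r - h r * (4 * \<sigma> * ?w r)) (at r)"
      by (rule derivative_eq_intros h[OF r(2)] h'[OF r(2)] deriv_ab deriv2_ab refl)+ (simp add: algebra_simps)
    note d = DERIV_cmult_right[OF DERIV_cmult[OF this, of K]]
    show ?thesis
      by (rule cong, assumption, rule partial_coordI)
        (use d in \<open>simp add: r K_def flip: has_real_derivative_iff_has_vector_derivative\<close>)
  qed
  have V45: "partial i (?V i) x = 0" if "i \<in> {4, 5}" for i
  proof -
    have "?V i y = 0" if "y \<in> U" for y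
      using that \<open>i \<in> {4, 5}\<close> G4 G5 by auto
    note cong = partial_cong[OF U_open x this, THEN trans]
    show ?thesis
      by (rule cong, assumption) (simp add: partial_def)
  qed
  have V4: "partial 4 (?V 4) x = 0" and V5: "partial 5 (?V 5) x = 0" by (rule V45; simp)+
  have "local_laplacian (warped_metric a b) X ?G x = (\<Sum>i\<in>UNIV. partial i (?V i) x) / sqrt (\<Prod>j\<in>UNIV. ?m x j)"
    unfolding X by (rule local_laplacian_orthogonal[OF U_open x metric_matrix_stereo_param[OF e d] m_pos])
  also have "(\<Sum>i\<in>UNIV. partial i (?V i) x) = 4 * (b r)\<^sup>2 / (\<rho> (x $ 4) (x $ 5))\<^sup>2 * (h r / ?w r) * (Suu (x $ 1) (x $ 2) + Svv (x $ 1) (x $ 2))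
      + K * (h'' r * ?w r - h r * (4 * \<sigma> * ?w r)) * S (x $ 1) (x $ 2)"
    unfolding sum_5 V1 V2 V3 V4 V5 by (simp add: distrib_left)
  also have "Suu (x $ 1) (x $ 2) + Svv (x $ 1) (x $ 2) = 4 / (\<rho> (x $ 1) (x $ 2))\<^sup>2 * (c * S (x $ 1) (x $ 2))"
    using \<rho>[of "x $ 1" "x $ 2"] by (simp add: eig[symmetric] flip: \<rho>_def)
  also have "4 * (b r)\<^sup>2 / (\<rho> (x $ 4) (x $ 5))\<^sup>2 * (h r / ?w r) * (4 / (\<rho> (x $ 1) (x $ 2))\<^sup>2 * (c * S (x $ 1) (x $ 2)))
    = K * (b r / a r * h r * c * S (x $ 1) (x $ 2))"
    using nz by (simp add: K_def power2_eq_square mult_ac)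
  also have "K * (b r / a r * h r * c * S (x $ 1) (x $ 2)) + K * (h'' r * ?w r - h r * (4 * \<sigma> * ?w r)) * S (x $ 1) (x $ 2)
    = K * (?w r)\<^sup>2 * ((h'' r - 4 * \<sigma> * h r + c / (a r)\<^sup>2 * h r) / ?w r * S (x $ 1) (x $ 2))"
    using nz(1,2) by (simp add: field_simps power2_eq_square)
  also have "\<dots> / sqrt (\<Prod>j\<in>UNIV. ?m x j)
    = (h'' r - 4 * \<sigma> * h r + c / (a r)\<^sup>2 * h r) / ?w r * S (x $ 1) (x $ 2)"
  proof -
    have "sqrt (\<Prod>j\<in>UNIV. ?m x j) = K * (?w r)\<^sup>2" by (simp add: vol r K_def)
    moreover have "K * (?w r)\<^sup>2 \<noteq> 0" using nz by (simp add: K_def)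
    ultimately show ?thesis by simp
  qed
  also have "S (x $ 1) (x $ 2) = s \<theta>"
    using Xx by (simp add: X stereo_param_def S_def)
  finally show "local_laplacian (warped_metric a b) X ?G x =
    (h'' r - 4 * \<sigma> * h r + c / (a r)\<^sup>2 * h r) / ?w r * s \<theta>" .
qed (rule region_atlas_inj)

section \<open>Multiplication of harmonic functions by the distance\<close>

lemma ab_pos: "r \<in> I \<Longrightarrow> a r * b r > 0"
  by (simp add: a_pos b_pos)

text \<open>If \<open>F = (h / w) s\<close> is harmonic, then \<open>r F\<close> has profile \<open>r h\<close>, and of its second derivative
  \<open>2 h' + r h''\<close> only \<open>2 h'\<close> survives, since \<open>h\<close> satisfies the harmonic equation. The result has
  profile \<open>2 h'\<close> in the same normalization, so the Laplacian can be applied once more.\<close>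
lemma laplacian_times_r:
  assumes h: "\<And>r. r \<in> I \<Longrightarrow> (h has_real_derivative h' r) (at r)"
    and h': "\<And>r. r \<in> I \<Longrightarrow> (h' has_real_derivative 4 * \<sigma> * h r - c / (a r)\<^sup>2 * h r) (at r)"
    and s: "sphere_eigenfunction c s"
    and F: "\<And>\<theta> r \<phi>. (\<theta>, r, \<phi>) \<in> region I \<Longrightarrow> F (\<theta>, r, \<phi>) = h r / (a r * b r) * s \<theta>"
    and p: "(\<theta>, r, \<phi>) \<in> region I"
  shows "laplacian I a b (times_r F) (\<theta>, r, \<phi>) = 2 * h' r / (a r * b r) * s \<theta>"
proof -
  have "((\<lambda>r. r * h r) has_real_derivative h r + r * h' r) (at r)" if "r \<in> I" for r
    using h[OF that] by (auto intro!: derivative_eq_intros)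
  moreover have "((\<lambda>r. h r + r * h' r) has_real_derivative
      2 * h' r + r * (4 * \<sigma> * h r - c / (a r)\<^sup>2 * h r)) (at r)" if "r \<in> I" for r
    using h[OF that] h'[OF that] by (auto intro!: derivative_eq_intros)
  moreover have "times_r F (\<theta>, r, \<phi>) = r * h r / (a r * b r) * s \<theta>" if "(\<theta>, r, \<phi>) \<in> region I" for \<theta> r \<phi>
    using F[OF that] by (simp add: times_r_def)
  ultimately have "laplacian I a b (times_r F) (\<theta>, r, \<phi>) =
     (2 * h' r + r * (4 * \<sigma> * h r - c / (a r)\<^sup>2 * h r) - 4 * \<sigma> * (r * h r) + c / (a r)\<^sup>2 * (r * h r))
       / (a r * b r) * s \<theta>"
    by (rule laplacian_separated[OF _ _ s _ p])
  then show ?thesis by (simp add: algebra_simps)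
qed

text \<open>For a radial harmonic function the profile satisfies \<open>h'' = 4 \<sigma> h\<close>. This equation has constant
  coefficients, so \<open>h'\<close> satisfies it too, and the Laplacian \<open>2 h' / w\<close> of \<open>r F\<close> is again harmonic. If it
  vanished identically, then so would \<open>h'' = 4 \<sigma> h\<close> and hence \<open>F\<close>, as \<open>\<sigma> \<noteq> 0\<close>; for \<open>\<sigma> = 0\<close> a constant
  \<open>h\<close> would be a counterexample.\<close>
lemma radial_harmonic_times_r:
  assumes curved: "\<sigma> \<noteq> 0" and rad: "radial I F" and harm: "proper_harmonic I a b F"
  shows "proper_biharmonic I a b (times_r F)"
proof -
  have smooth: "smooth I F" and lap: "\<And>p. p \<in> region I \<Longrightarrow> laplacian I a b F p = 0"
    and nonzero: "\<exists>p\<in>region I. F p \<noteq> 0"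
    using harm by (auto simp: proper_harmonic_def harmonic_def)
  obtain f f' f'' where f: "\<And>r. r \<in> I \<Longrightarrow> (f has_real_derivative f' r) (at r)"
    and f': "\<And>r. r \<in> I \<Longrightarrow> (f' has_real_derivative f'' r) (at r)"
    and Ff: "\<And>\<theta> r \<phi>. (\<theta>, r, \<phi>) \<in> region I \<Longrightarrow> F (\<theta>, r, \<phi>) = f r"
    using radial_profile[OF open_I smooth rad] by metis
  define h where "h r = a r * b r * f r" for r
  define h' where "h' r = ((b r)\<^sup>2 + \<sigma> * (a r)\<^sup>2) * f r + a r * b r * f' r" for r
  define h'' where "h'' r = 4 * \<sigma> * (a r * b r) * f r + 2 * ((b r)\<^sup>2 + \<sigma> * (a r)\<^sup>2) * f' r + a r * b r * f'' r" for r
  have h: "(h has_real_derivative h' r) (at r)" if "r \<in> I" for r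
    unfolding h_def h'_def
    by (rule derivative_eq_intros deriv_ab f[OF that] refl)+ (simp add: algebra_simps)
  have h'h'': "(h' has_real_derivative h'' r) (at r)" if "r \<in> I" for r
    unfolding h'_def h''_def
    by (rule derivative_eq_intros deriv_ab deriv2_ab f[OF that] f'[OF that] refl)+ (simp add: algebra_simps)
  have Fh: "F (\<theta>, r, \<phi>) = h r / (a r * b r) * 1" if "(\<theta>, r, \<phi>) \<in> region I" for \<theta> r \<phi>
    using ab_pos[of r] that Ff[OF that] by (auto simp: h_def region_def)
  have mem: "(axis 1 1, r, axis 1 1) \<in> region I" if "r \<in> I" for r
    using that by (simp add: region_def)
  \<comment> \<open>The constant function 1 on the sphere has eigenvalue 0, so harmonicity is the profile equation.\<close>
  have h''_eq: "h'' r = 4 * \<sigma> * h r" if r: "r \<in> I" for r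
    using lap[OF mem[OF r]] ab_pos[OF r]
      laplacian_separated[OF h h'h'' sphere_eigenfunction_const Fh mem[OF r]]
    by auto
  have h': "(h' has_real_derivative 4 * \<sigma> * h r) (at r)" if "r \<in> I" for r
    using h'h''[OF that] by (simp only: h''_eq[OF that])
  have lap1: "laplacian I a b (times_r F) (\<theta>, r, \<phi>) = 2 * h' r / (a r * b r) * 1"
    if "(\<theta>, r, \<phi>) \<in> region I" for \<theta> r \<phi>
    by (rule laplacian_times_r[OF h _ sphere_eigenfunction_const Fh that]) (simp_all add: h')
  have "laplacian I a b (laplacian I a b (times_r F)) (\<theta>, r, \<phi>) = 0"
    if "(\<theta>, r, \<phi>) \<in> region I" for \<theta> r \<phi>
  proof -
    have d1: "((\<lambda>r. 2 * h' r) has_real_derivative 2 * (4 * \<sigma> * h r)) (at r)" if "r \<in> I" for r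
      by (rule DERIV_cmult[OF h'[OF that]])
    have d2: "((\<lambda>r. 2 * (4 * \<sigma> * h r)) has_real_derivative 2 * (4 * \<sigma> * h' r)) (at r)" if "r \<in> I" for r
      by (intro DERIV_cmult h[OF that])
    show ?thesis
      using laplacian_separated[OF d1 d2 sphere_eigenfunction_const lap1 that] by simp
  qed
  moreover have "\<exists>p\<in>region I. laplacian I a b (times_r F) p \<noteq> 0"
  proof (rule ccontr)
    assume "\<not> ?thesis"
    then have zero: "h' r = 0" if "r \<in> I" for r
      using lap1[OF mem[OF that]] mem[OF that] ab_pos[OF that] by auto
    have h0: "4 * \<sigma> * h r = 0" if "r \<in> I" for r
    proof -
      have "(h' has_real_derivative 0) (at r)"
        by (rule has_field_derivative_transform_within_open[of "\<lambda>_. 0", OF _ open_I that]) (simp_all add: zero)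
      with h'[OF that] show ?thesis by (rule DERIV_unique)
    qed
    have "F (\<theta>, r, \<phi>) = 0" if "(\<theta>, r, \<phi>) \<in> region I" for \<theta> r \<phi>
      using h0[of r] curved that Fh[OF that] by (simp add: region_def)
    then show False using nonzero by auto
  qed
  ultimately show ?thesis
    using smooth_times_r[OF open_I smooth] by (auto simp: proper_biharmonic_def biharmonic_def)
qed

text \<open>The profile \<open>h = a\<^sup>2\<close> belongs to \<open>h / w = a / b\<close>, that is to \<open>tan\<close> or \<open>tanh\<close>.\<close>
lemma tangent_profile:
  "((\<lambda>r. (a r)\<^sup>2) has_real_derivative 2 * (a r * b r)) (at r)"
  "((\<lambda>r. 2 * (a r * b r)) has_real_derivative 2 * ((b r)\<^sup>2 + \<sigma> * (a r)\<^sup>2)) (at r)"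
  by (auto intro!: derivative_eq_intros deriv_a deriv_b simp: power2_eq_square)

text \<open>For a factor of eigenvalue \<open>-2\<close> the profile equation \<open>h'' = 4 \<sigma> h + 2 h / a\<^sup>2\<close> has variable
  coefficients and is not inherited by \<open>h'\<close>. It is solved by \<open>h = a\<^sup>2\<close>, because
  \<open>(a\<^sup>2)'' = 2 b\<^sup>2 + 2 \<sigma> a\<^sup>2 = 4 \<sigma> a\<^sup>2 + 2\<close>. Here \<open>2 h' = 4 w\<close>, so the Laplacian of \<open>r F\<close> is simply
  \<open>4 \<theta>\<^sub>1\<close>, whose Laplacian is \<open>- 8 \<theta>\<^sub>1 / a\<^sup>2\<close>.\<close>
lemma nonradial_harmonic_times_r:
  assumes "I \<noteq> {}"
  defines "F \<equiv> \<lambda>(\<theta>, r, \<phi>). a r / b r * \<theta> $ 1"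
  shows "\<not> radial I F" "proper_harmonic I a b F" "\<not> biharmonic I a b (times_r F)"
proof -
  obtain r0 where r0: "r0 \<in> I" using assms(1) by blast
  let ?p = "(axis 1 1, r0, axis 1 1) :: point" and ?q = "(- axis 1 1, r0, axis 1 1) :: point"
  have p: "?p \<in> region I" and q: "?q \<in> region I" using r0 by (simp_all add: region_def)
  have pos: "a r0 > 0" "b r0 > 0" using r0 a_pos b_pos by auto
  have Fp: "F ?p = a r0 / b r0" and Fq: "F ?q = - (a r0 / b r0)" by (simp_all add: F_def)
  show "\<not> radial I F"
  proof
    assume "radial I F"
    then obtain f where "\<forall>(\<theta>, r, \<phi>)\<in>region I. F (\<theta>, r, \<phi>) = f r" unfolding radial_def by blast
    from bspec[OF this p] bspec[OF this q] have "F ?p = F ?q" by simp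
    then show False using Fp Fq pos by simp
  qed
  have FS: "F (\<theta>, r, \<phi>) = (a r)\<^sup>2 / (a r * b r) * \<theta> $ 1" if "(\<theta>, r, \<phi>) \<in> region I" for \<theta> r \<phi>
  proof -
    have "a r > 0" "b r > 0" using that a_pos b_pos by (auto simp: region_def)
    then show ?thesis by (simp add: F_def power2_eq_square)
  qed
  have profile: "2 * ((b r)\<^sup>2 + \<sigma> * (a r)\<^sup>2) = 4 * \<sigma> * (a r)\<^sup>2 - - 2 / (a r)\<^sup>2 * (a r)\<^sup>2" if "r \<in> I" for r
    using a_pos[OF that] by (simp add: b_squared)
  have "smooth I F"
    unfolding smooth_def
  proof safe
    fix U X assume UX: "(U, X) \<in> region_atlas I"
    have U: "open U" using region_atlas_open[OF open_I UX] .
    let ?T = "\<lambda>x::real^5. (a (x $ 3) * inverse (b (x $ 3))) * ((2 * x $ 1) * inverse (x $ 1 * x $ 1 + x $ 2 * x $ 2 + 1))"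
    have "b (x $ 3) \<noteq> 0" if "x \<in> U" for x
      using UX that b_pos by (fastforce simp: region_atlas_def)
    moreover have "x $ 1 * x $ 1 + x $ 2 * x $ 2 + 1 \<noteq> 0" for x :: "real^5"
      using sphere_factor_pos[of "x $ 1" "x $ 2"] by (simp add: power2_eq_square)
    ultimately have "smooth_algebra U ?T"
      by (intro smooth_algebra.mult smooth_algebra.inverse smooth_algebra.add ballI)
        (auto intro!: smooth_algebra.base smooth_on_pair[OF U deriv_a deriv_b] smooth_on_nth[OF U] smooth_on_const)
    then have "smooth_on U ?T" by (rule smooth_algebra_smooth_on[OF U])
    moreover have "F \<circ> X = ?T"
      using UX by (auto simp: region_atlas_def F_def stereo_param_def stereo_nth divide_inverse power2_eq_square)
    ultimately show "smooth_on U (F \<circ> X)" by simp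
  qed
  moreover have "laplacian I a b F (\<theta>, r, \<phi>) = 0" if "(\<theta>, r, \<phi>) \<in> region I" for \<theta> r \<phi>
  proof -
    have "r \<in> I" using that by (simp add: region_def)
    from profile[OF this]
    show ?thesis
      using laplacian_separated[OF tangent_profile sphere_eigenfunction_nth FS that] by simp
  qed
  ultimately show "proper_harmonic I a b F"
    using Fp p pos by (auto simp: proper_harmonic_def harmonic_def intro!: bexI[of _ ?p])
  have lap1: "laplacian I a b (times_r F) (\<theta>, r, \<phi>) = 4 * (a r * b r) / (a r * b r) * \<theta> $ 1"
    if "(\<theta>, r, \<phi>) \<in> region I" for \<theta> r \<phi>
  proof -
    have "((\<lambda>r. 2 * (a r * b r)) has_real_derivative 4 * \<sigma> * (a r)\<^sup>2 - - 2 / (a r)\<^sup>2 * (a r)\<^sup>2) (at r)"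
      if "r \<in> I" for r
      using tangent_profile(2)[of r] by (simp only: profile[OF that])
    from laplacian_times_r[OF tangent_profile(1) this sphere_eigenfunction_nth FS that]
    show ?thesis by simp
  qed
  have "((\<lambda>r. 4 * (a r * b r)) has_real_derivative 4 * ((b r)\<^sup>2 + \<sigma> * (a r)\<^sup>2)) (at r)"
    "((\<lambda>r. 4 * ((b r)\<^sup>2 + \<sigma> * (a r)\<^sup>2)) has_real_derivative 4 * (4 * \<sigma> * (a r * b r))) (at r)" for r
    by (intro DERIV_cmult deriv_ab deriv2_ab)+
  from laplacian_separated[OF this sphere_eigenfunction_nth lap1 p]
  have "laplacian I a b (laplacian I a b (times_r F)) ?p = - 8 / (a r0)\<^sup>2"
    using pos by simp
  then show "\<not> biharmonic I a b (times_r F)"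
    using p pos by (force simp: biharmonic_def)
qed

end

lemma warped_pair_trig: "warped_pair {0<..<pi/2} sin cos (-1)"
  by unfold_locales (auto intro!: derivative_eq_intros sin_gt_zero cos_gt_zero simp: cos_squared_eq)

lemma warped_pair_hyperbolic: "warped_pair {0<..} sinh cosh 1"
  by unfold_locales (auto intro!: derivative_eq_intros simp: cosh_square_eq)

theorem theorem3p2:
  fixes I :: "real set" and a b :: "real \<Rightarrow> real"
  assumes "(I = {0<..<pi/2} \<and> a = sin \<and> b = cos) \<or> (I = {0<..} \<and> a = sinh \<and> b = cosh)"
  shows "(\<forall>F. radial I F \<and> proper_harmonic I a b F \<longrightarrow> proper_biharmonic I a b (times_r F)) \<and>
    (\<exists>F. \<not> radial I F \<and> proper_harmonic I a b F \<and> \<not> biharmonic I a b (times_r F))"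
proof -
  obtain \<sigma> where \<sigma>: "warped_pair I a b \<sigma>" "\<sigma> \<noteq> 0"
    using assms warped_pair_trig warped_pair_hyperbolic
    by (metis neg_equal_0_iff_equal zero_neq_one)
  interpret warped_pair I a b \<sigma> by (rule \<sigma>(1))
  have "(1::real) < pi / 2" using pi_gt3 by simp
  then have "1 \<in> I" using assms by auto
  then have "I \<noteq> {}" by blast
  then show ?thesis
    using radial_harmonic_times_r[OF \<sigma>(2)] nonradial_harmonic_times_r by blast
qed

end
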